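(* For every (finite or infinite) ordinal $\kappa>0$ there exist a set $Z$, a family $\mathcal{Y}\subseteq\mathcal{P}(Z)$ and a function $\mu:\mathcal{Y}\to\mathcal{P}(Z)$ such that: (a) $(\mu PR)$ and $(\mu\subseteq)$ hold; (b) $(\mu CUM)$ holds; (c) $(\bigcap)$ holds, i.e. $\mathcal{Y}$ is closed under arbitrary intersections; (d) $(\mu Cumt\,\alpha)$ holds for all ordinals $\alpha<\kappa$; (e) $(\mu Cum\,\kappa)$ fails.
   Context: $\mathcal{P}(Z)$ denotes the power set of $Z$. For a family $\mathcal{Y}\subseteq\mathcal{P}(Z)$ and a function $\mu:\mathcal{Y}\to\mathcal{P}(Z)$ the following conditions are used. All sets named $U$, $X$, $Y$, $X_\gamma$ below range over elements of $\mathcal{Y}$. - $(\mu\subseteq)$: $\mu(X)\subseteq X$ for all $X$. - $(\mu PR)$: $X\subseteq Y$ implies $\mu(Y)\cap X\subseteq\mu(X)$. - $(\mu CUM)$: $\mu(X)\subseteq Y\subseteq X$ implies $\mu(X)=\mu(Y)$. - $(\bigcap)$: $\mathcal{Y}$ is closed under arbitrary intersections (of nonempty families of elements of $\mathcal{Y}$). - $(\mu Cum\,\alpha)$, for an ordinal $\alpha$: for all $U$ and all sequences $(X_\gamma)_{\gamma\le\alpha}$, if $\mu(X_\beta)\subseteq U\cup\bigcup\{X_\gamma:\gamma<\beta\}$ for all $\beta\le\alpha$, then $\bigcap\{X_\gamma:\gamma\le\alpha\}\cap\mu(U)\subseteq\mu(X_\alpha)$. - $(\mu Cumt\,\alpha)$,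 for an ordinal $\alpha$: for all $U$ and all sequences $(X_\gamma)_{\gamma\le\alpha}$, if $\mu(X_\beta)\subseteq U\cup\bigcup\{X_\gamma:\gamma<\beta\}$ for all $\beta\le\alpha$, then $X_\alpha\cap\mu(U)\subseteq\mu(X_\alpha)$. *)

theory Defs
  imports "HOL-Library.FuncSet"
begin

text \<open>
  Ordinals are represented by the elements of a well-order \<open>r\<close> on an arbitrary type: an element
  \<open>\<alpha>\<close> of \<open>Field r\<close> stands for the order type of \<open>underS r \<alpha>\<close>. The ordinals below \<open>\<alpha>\<close> are then the
  elements of \<open>underS r \<alpha>\<close>, and those up to and including \<open>\<alpha>\<close> are the elements of \<open>under r \<alpha>\<close>.
  Every ordinal arises in this way, by adjoining a greatest element to a well-order of that type.
\<close>

definition mu_subset :: "'a set set \<Rightarrow> ('a set \<Rightarrow> 'a set) \<Rightarrow> bool" where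
  "mu_subset Y \<mu> \<longleftrightarrow> (\<forall>A\<in>Y. \<mu> A \<subseteq> A)"

definition mu_PR :: "'a set set \<Rightarrow> ('a set \<Rightarrow> 'a set) \<Rightarrow> bool" where
  "mu_PR Y \<mu> \<longleftrightarrow> (\<forall>A\<in>Y. \<forall>B\<in>Y. A \<subseteq> B \<longrightarrow> \<mu> B \<inter> A \<subseteq> \<mu> A)"

definition mu_CUM :: "'a set set \<Rightarrow> ('a set \<Rightarrow> 'a set) \<Rightarrow> bool" where
  "mu_CUM Y \<mu> \<longleftrightarrow> (\<forall>A\<in>Y. \<forall>B\<in>Y. \<mu> A \<subseteq> B \<and> B \<subseteq> A \<longrightarrow> \<mu> A = \<mu> B)"

definition Inter_closed :: "'a set set \<Rightarrow> bool" where
  "Inter_closed Y \<longleftrightarrow> (\<forall>F. F \<subseteq> Y \<and> F \<noteq> {} \<longrightarrow> \<Inter>F \<in> Y)"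

text \<open>A sequence indexed by the ordinals up to \<open>\<alpha>\<close> is a total function of which only the
  values on \<open>under r \<alpha>\<close> are used.\<close>

definition Cum_sequence ::
  "'i rel \<Rightarrow> 'i \<Rightarrow> 'a set set \<Rightarrow> ('a set \<Rightarrow> 'a set) \<Rightarrow> 'a set \<Rightarrow> ('i \<Rightarrow> 'a set) \<Rightarrow> bool" where
  "Cum_sequence r \<alpha> Y \<mu> U X \<longleftrightarrow>
     (\<forall>\<gamma>\<in>under r \<alpha>. X \<gamma> \<in> Y) \<and>
     (\<forall>\<beta>\<in>under r \<alpha>. \<mu> (X \<beta>) \<subseteq> U \<union> (\<Union>\<gamma>\<in>underS r \<beta>. X \<gamma>))"

definition mu_Cum :: "'i rel \<Rightarrow> 'i \<Rightarrow> 'a set set \<Rightarrow> ('a set \<Rightarrow> 'a set) \<Rightarrow> bool" where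
  "mu_Cum r \<alpha> Y \<mu> \<longleftrightarrow>
     (\<forall>U\<in>Y. \<forall>X. Cum_sequence r \<alpha> Y \<mu> U X \<longrightarrow> (\<Inter>\<gamma>\<in>under r \<alpha>. X \<gamma>) \<inter> \<mu> U \<subseteq> \<mu> (X \<alpha>))"

definition mu_Cumt :: "'i rel \<Rightarrow> 'i \<Rightarrow> 'a set set \<Rightarrow> ('a set \<Rightarrow> 'a set) \<Rightarrow> bool" where
  "mu_Cumt r \<alpha> Y \<mu> \<longleftrightarrow>
     (\<forall>U\<in>Y. \<forall>X. Cum_sequence r \<alpha> Y \<mu> U X \<longrightarrow> X \<alpha> \<inter> \<mu> U \<subseteq> \<mu> (X \<alpha>))"

end

theory Submission
  imports Defs
begin

text \<open>
  Take two kinds of points \<open>d\<^sub>\<gamma>\<close> and \<open>a\<^sub>\<gamma>\<close>, and write \<open>c = d\<^sub>\<kappa>\<close>. Let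
  \<open>K\<^sub>\<gamma> = {c, a\<^sub>\<gamma>} \<union> {d\<^sub>\<delta>. \<delta> \<le> \<gamma>}\<close> for \<open>\<gamma> \<le> \<kappa>\<close>, and let \<open>\<mu>\<close> delete \<open>d\<^sub>\<gamma>\<close> from \<open>K\<^sub>\<gamma>\<close> and be
  the identity on every other set of the family. With \<open>U = {c} \<union> {a\<^sub>\<gamma>. \<gamma> \<le> \<kappa>}\<close> the sequence \<open>K\<close>
  satisfies the hypothesis of \<open>\<mu>Cum \<kappa>\<close>: every point that \<open>\<mu>\<close> leaves in \<open>K\<^sub>\<beta>\<close> lies in \<open>U\<close>
  or is a \<open>d\<^sub>\<delta>\<close> with \<open>\<delta> < \<beta>\<close>, hence belongs to \<open>K\<^sub>\<delta>\<close>. But \<open>c\<close> belongs to \<open>\<mu> U = U\<close> and to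
  all the \<open>K\<^sub>\<gamma>\<close>, and \<open>\<mu>\<close> deletes it from \<open>K\<^sub>\<kappa>\<close>.

  A shorter sequence cannot violate \<open>\<mu>Cumt\<close>. A violation has to end in some \<open>K\<^sub>\<gamma>\<close> with
  \<open>d\<^sub>\<gamma> \<in> \<mu> U\<close>. The points \<open>a\<^sub>\<gamma>\<close> are never deleted, so a sequence cannot introduce new ones
  (lemma \<open>tag_in_start\<close>), and \<open>a\<^sub>\<gamma> \<in> U\<close>. As \<open>\<mu>\<close> keeps \<open>d\<^sub>\<gamma>\<close> in \<open>U\<close>, this forces \<open>\<gamma> = \<kappa>\<close> and
  keeps every \<open>d\<^sub>\<delta>\<close> with \<open>\<delta> < \<kappa>\<close> out of \<open>U\<close>. So such a \<open>d\<^sub>\<delta>\<close> has to be introduced by a set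
  from which \<open>\<mu>\<close> deletes it. That set is \<open>K\<^sub>\<delta>\<close>, which requires all smaller \<open>d\<^sub>\<epsilon>\<close> to be present
  already; hence \<open>d\<^sub>\<delta>\<close> does not occur before position \<open>\<delta>\<close> (lemma \<open>chain_index_le\<close>), and \<open>K\<^sub>\<kappa>\<close>
  does not occur before position \<open>\<kappa>\<close>.

  The family is closed under intersections while the \<open>K\<^sub>\<gamma>\<close> are maximal in it: it consists of all
  sets containing \<open>c\<close> in which some \<open>a\<^sub>\<gamma>\<close> and some \<open>d\<^sub>\<delta>\<close> with \<open>\<delta> < \<kappa>\<close> occur together only if
  the whole set is \<open>K\<^sub>\<gamma>\<close> with \<open>\<gamma> \<le> \<kappa>\<close>. Both \<open>\<mu>PR\<close> and \<open>\<mu>CUM\<close> follow from this maximality.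
\<close>

section \<open>The family and its choice function\<close>

text \<open>The points \<open>d\<^sub>i\<close> and \<open>a\<^sub>i\<close>; lists provide two disjoint copies of the index type.\<close>

abbreviation chain_pt :: "'i \<Rightarrow> 'i list" where
  "chain_pt i \<equiv> [i]"

abbreviation tag_pt :: "'i \<Rightarrow> 'i list" where
  "tag_pt i \<equiv> [i, i]"

locale positive_ordinal =
  fixes r :: "'i rel" and \<kappa> :: 'i
  assumes wo: "Well_order r"
    and \<kappa>_Field: "\<kappa> \<in> Field r"
    and \<kappa>_pos: "underS r \<kappa> \<noteq> {}"
begin

definition K :: "'i \<Rightarrow> 'i list set" where
  "K \<gamma> = {chain_pt \<kappa>, tag_pt \<gamma>} \<union> chain_pt ` under r \<gamma>"

definition start :: "'i list set" where
  "start = insert (chain_pt \<kappa>) (tag_pt ` under r \<kappa>)"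

definition family :: "'i list set set" where
  "family = {A. chain_pt \<kappa> \<in> A \<and>
     (\<forall>\<gamma>. \<forall>\<delta>\<in>underS r \<kappa>. tag_pt \<gamma> \<in> A \<and> chain_pt \<delta> \<in> A \<longrightarrow> \<gamma> \<in> under r \<kappa> \<and> A = K \<gamma>)}"

definition choice :: "'i list set \<Rightarrow> 'i list set" where
  "choice A = A - {chain_pt \<gamma> |\<gamma>. \<gamma> \<in> under r \<kappa> \<and> A = K \<gamma>}"

lemma r_refl: "\<alpha> \<in> Field r \<Longrightarrow> (\<alpha>, \<alpha>) \<in> r"
  and r_trans: "(\<alpha>, \<beta>) \<in> r \<Longrightarrow> (\<beta>, \<gamma>) \<in> r \<Longrightarrow> (\<alpha>, \<gamma>) \<in> r"
  and r_antisym: "(\<alpha>, \<beta>) \<in> r \<Longrightarrow> (\<beta>, \<alpha>) \<in> r \<Longrightarrow> \<alpha> = \<beta>"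
  and r_total: "\<alpha> \<in> Field r \<Longrightarrow> \<beta> \<in> Field r \<Longrightarrow> (\<alpha>, \<beta>) \<in> r \<or> (\<beta>, \<alpha>) \<in> r"
  and r_wf: "wf (r - Id)"
proof -
  have lin: "Linear_order r" and w: "wf (r - Id)"
    using wo unfolding well_order_on_def by auto
  then have R: "refl_on (Field r) r" and T: "trans r" and A: "antisym r"
    and tot: "total_on (Field r) r"
    unfolding linear_order_on_def partial_order_on_def preorder_on_def by auto
  show refl: "(\<alpha>, \<alpha>) \<in> r" if "\<alpha> \<in> Field r" for \<alpha>
    using R that by (rule refl_onD)
  show "(\<alpha>, \<beta>) \<in> r \<Longrightarrow> (\<beta>, \<gamma>) \<in> r \<Longrightarrow> (\<alpha>, \<gamma>) \<in> r"
    using T by (rule transD)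
  show "(\<alpha>, \<beta>) \<in> r \<Longrightarrow> (\<beta>, \<alpha>) \<in> r \<Longrightarrow> \<alpha> = \<beta>"
    using A by (rule antisymD)
  show "\<alpha> \<in> Field r \<Longrightarrow> \<beta> \<in> Field r \<Longrightarrow> (\<alpha>, \<beta>) \<in> r \<or> (\<beta>, \<alpha>) \<in> r"
    using tot refl unfolding total_on_def by metis
  show "wf (r - Id)" by (rule w)
qed

lemma under_iff: "\<alpha> \<in> under r \<beta> \<longleftrightarrow> (\<alpha>, \<beta>) \<in> r"
  by (simp add: under_def)

lemma underS_iff: "\<alpha> \<in> underS r \<beta> \<longleftrightarrow> \<alpha> \<noteq> \<beta> \<and> (\<alpha>, \<beta>) \<in> r"
  by (simp add: underS_def)

lemma underS_under_trans: "\<alpha> \<in> underS r \<beta> \<Longrightarrow> \<beta> \<in> under r \<gamma> \<Longrightarrow> \<alpha> \<in> under r \<gamma>"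
  unfolding under_iff underS_iff by (blast intro: r_trans)

lemma K_has_tag: "tag_pt \<gamma> \<in> K \<gamma>"
  by (simp add: K_def)

lemma K_has_chain:
  assumes "\<gamma> \<in> under r \<kappa>"
  obtains \<delta> where "\<delta> \<in> underS r \<kappa>" "chain_pt \<delta> \<in> K \<gamma>"
proof (cases "\<gamma> = \<kappa>")
  case True
  then show ?thesis
    using \<kappa>_pos that by (auto simp: K_def under_def underS_def)
next
  case False
  then have "\<gamma> \<in> underS r \<kappa>" "(\<gamma>, \<gamma>) \<in> r"
    using assms r_refl by (auto simp: under_def underS_def Field_def)
  then show ?thesis
    using that by (auto simp: K_def under_def)
qed

lemma chain_pt_in_K: "\<gamma> \<in> under r \<kappa> \<Longrightarrow> chain_pt \<gamma> \<in> K \<gamma>"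
  using r_refl[of \<gamma>] by (auto simp: K_def under_def Field_def)

lemma eq_K:
  assumes "A \<in> family" "tag_pt \<gamma> \<in> A" "chain_pt \<delta> \<in> A" "\<delta> \<in> underS r \<kappa>"
  shows "A = K \<gamma>" and "\<gamma> \<in> under r \<kappa>"
  using assms unfolding family_def by blast+

lemma K_maximal:
  assumes "A \<in> family" "\<gamma> \<in> under r \<kappa>" "K \<gamma> \<subseteq> A"
  shows "A = K \<gamma>"
proof -
  obtain \<delta> where "\<delta> \<in> underS r \<kappa>" "chain_pt \<delta> \<in> K \<gamma>"
    using K_has_chain[OF assms(2)] by blast
  then show ?thesis
    using eq_K(1)[OF assms(1)] assms(3) K_has_tag by blast
qed

lemma K_in_family: "\<gamma> \<in> under r \<kappa> \<Longrightarrow> K \<gamma> \<in> family"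
  by (auto simp: family_def K_def)

lemma start_in_family: "start \<in> family"
  by (auto simp: family_def start_def underS_def)

text \<open>A set of the family having both an \<open>a\<^sub>\<gamma>\<close> and a \<open>d\<^sub>\<delta>\<close> with \<open>\<delta> < \<kappa>\<close> is determined by
  \<open>\<gamma>\<close>. So if an intersection has both, then all the intersected sets coincide.\<close>

lemma Inter_closed_family: "Inter_closed family"
  unfolding Inter_closed_def
proof (intro allI impI, elim conjE)
  fix F assume F: "F \<subseteq> family" "F \<noteq> {}"
  have "\<gamma> \<in> under r \<kappa> \<and> \<Inter>F = K \<gamma>"
    if "\<delta> \<in> underS r \<kappa>" "tag_pt \<gamma> \<in> \<Inter>F" "chain_pt \<delta> \<in> \<Inter>F" for \<gamma> \<delta>
  proof -
    have "\<forall>A\<in>F. \<gamma> \<in> under r \<kappa> \<and> A = K \<gamma>"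
      using F(1) that eq_K by blast
    then show ?thesis
      using F(2) by auto
  qed
  then show "\<Inter>F \<in> family"
    using F(1) unfolding family_def by blast
qed

lemma choice_subset: "choice A \<subseteq> A"
  by (auto simp: choice_def)

lemma choice_deletedD:
  assumes "x \<in> A" "x \<notin> choice A"
  shows "\<exists>\<gamma>\<in>under r \<kappa>. A = K \<gamma> \<and> x = chain_pt \<gamma>"
  using assms by (auto simp: choice_def)

lemma tag_in_choice: "tag_pt \<gamma> \<in> A \<Longrightarrow> tag_pt \<gamma> \<in> choice A"
  by (auto simp: choice_def)

lemma choice_start: "choice start = start"
proof -
  have "start \<noteq> K \<gamma>" if "\<gamma> \<in> under r \<kappa>" for \<gamma>
  proof
    assume "start = K \<gamma>"
    moreover obtain \<delta> where "\<delta> \<in> underS r \<kappa>" "chain_pt \<delta> \<in> K \<gamma>"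
      using K_has_chain[OF \<open>\<gamma> \<in> under r \<kappa>\<close>] by blast
    ultimately show False
      by (auto simp: start_def underS_def)
  qed
  then show ?thesis
    by (auto simp: choice_def)
qed

lemma K_inj:
  assumes "K \<gamma> = K \<delta>"
  shows "\<gamma> = \<delta>"
proof -
  have "tag_pt \<gamma> \<in> K \<delta>"
    using K_has_tag[of \<gamma>] unfolding assms .
  then show ?thesis
    by (auto simp: K_def)
qed

lemma choice_K: "\<gamma> \<in> under r \<kappa> \<Longrightarrow> choice (K \<gamma>) = K \<gamma> - {chain_pt \<gamma>}"
  unfolding choice_def by (blast dest: K_inj)

section \<open>Coherence and cumulativity\<close>

lemma lower_chain_in_choice:
  assumes "\<gamma> \<in> under r \<kappa>" "\<delta> \<in> underS r \<gamma>"
  shows "chain_pt \<delta> \<in> choice (K \<gamma>)"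
proof -
  have "chain_pt \<delta> \<in> K \<gamma>" "\<delta> \<noteq> \<gamma>"
    using assms(2) by (auto simp: K_def under_iff underS_iff)
  then show ?thesis
    by (simp add: choice_K[OF assms(1)])
qed

lemma mu_PR_choice: "mu_PR family choice"
  unfolding mu_PR_def
proof (intro ballI impI subsetI)
  fix A B x
  assume A: "A \<in> family" and B: "B \<in> family" and sub: "A \<subseteq> B" and x: "x \<in> choice B \<inter> A"
  show "x \<in> choice A"
  proof (rule ccontr)
    assume "x \<notin> choice A"
    then obtain \<gamma> where \<gamma>: "\<gamma> \<in> under r \<kappa>" "A = K \<gamma>"
      using x choice_deletedD[of x A] by blast
    then have "B = A"
      using K_maximal[OF B] sub by auto
    then show False
      using x \<open>x \<notin> choice A\<close> by simp
  qed
qed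

lemma mu_CUM_choice: "mu_CUM family choice"
  unfolding mu_CUM_def
proof (intro ballI impI, elim conjE)
  fix A B
  assume A: "A \<in> family" and B: "B \<in> family" and sub: "choice A \<subseteq> B" "B \<subseteq> A"
  have "x \<in> choice A" if x: "x \<in> choice B" for x
  proof (rule ccontr)
    assume not: "x \<notin> choice A"
    have xB: "x \<in> B"
      using x choice_subset by auto
    then obtain \<gamma> where \<gamma>: "\<gamma> \<in> under r \<kappa>" "A = K \<gamma>" "x = chain_pt \<gamma>"
      using not sub choice_deletedD[of x A] by blast
    then have "K \<gamma> \<subseteq> B"
      using sub(1) xB by (auto simp: choice_K)
    then have "B = A"
      using K_maximal[OF B \<gamma>(1)] \<gamma>(2) by simp
    then show False
      using x not by simp
  qed
  moreover have "choice A \<subseteq> choice B"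
    using mu_PR_choice A B sub choice_subset[of A] unfolding mu_PR_def by blast
  ultimately show "choice A = choice B"
    by auto
qed

section \<open>Sequences of length less than \<open>\<kappa>\<close>\<close>

lemma tag_in_start:
  assumes seq: "Cum_sequence r \<alpha> family choice U X"
    and "\<beta> \<in> under r \<alpha>" "tag_pt \<gamma> \<in> X \<beta>"
  shows "tag_pt \<gamma> \<in> U"
  using assms(2,3)
proof (induction \<beta> rule: wf_induct_rule[OF r_wf])
  case (1 \<beta>)
  have "tag_pt \<gamma> \<in> U \<union> (\<Union>\<delta>\<in>underS r \<beta>. X \<delta>)"
    using seq 1(2) tag_in_choice[OF 1(3)] unfolding Cum_sequence_def by blast
  then show ?case
  proof
    assume "tag_pt \<gamma> \<in> (\<Union>\<delta>\<in>underS r \<beta>. X \<delta>)"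
    then obtain \<delta> where \<delta>: "\<delta> \<in> underS r \<beta>" "tag_pt \<gamma> \<in> X \<delta>" by blast
    have "\<delta> \<in> under r \<alpha>"
      using \<delta>(1) 1(2) by (rule underS_under_trans)
    then show ?case
      using 1(1)[of \<delta>] \<delta> by (auto simp: underS_def)
  qed
qed

text \<open>If \<open>\<mu>\<close> does not delete \<open>d\<^sub>\<delta>\<close> from \<open>X\<^sub>\<beta>\<close>, then \<open>d\<^sub>\<delta>\<close> occurred earlier. If it does, then
  \<open>X\<^sub>\<beta> = K\<^sub>\<delta>\<close>, and all smaller \<open>d\<^sub>\<epsilon>\<close> occurred earlier, so that \<open>\<beta>\<close> is above all \<open>\<epsilon> < \<delta>\<close>.\<close>

lemma chain_index_le:
  assumes seq: "Cum_sequence r \<alpha> family choice U X"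
    and U: "\<And>\<delta>. \<delta> \<in> underS r \<kappa> \<Longrightarrow> chain_pt \<delta> \<notin> U"
    and "\<beta> \<in> under r \<alpha>" "\<delta> \<in> underS r \<kappa>" "chain_pt \<delta> \<in> X \<beta>"
  shows "(\<delta>, \<beta>) \<in> r"
  using assms(3-)
proof (induction \<beta> arbitrary: \<delta> rule: wf_induct_rule[OF r_wf])
  case (1 \<beta>)
  have earlier: "\<exists>\<beta>'\<in>underS r \<beta>. (\<epsilon>, \<beta>') \<in> r"
    if \<epsilon>: "\<epsilon> \<in> underS r \<kappa>" "chain_pt \<epsilon> \<in> choice (X \<beta>)" for \<epsilon>
  proof -
    have "chain_pt \<epsilon> \<in> U \<union> (\<Union>\<delta>\<in>underS r \<beta>. X \<delta>)"
      using seq 1(2) \<epsilon>(2) unfolding Cum_sequence_def by blast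
    then obtain \<beta>' where \<beta>': "\<beta>' \<in> underS r \<beta>" "chain_pt \<epsilon> \<in> X \<beta>'"
      using U[OF \<epsilon>(1)] by blast
    moreover have "\<beta>' \<in> under r \<alpha>"
      using \<beta>'(1) 1(2) by (rule underS_under_trans)
    ultimately show ?thesis
      using 1(1)[of \<beta>' \<epsilon>] \<epsilon>(1) by (auto simp: underS_def)
  qed
  show ?case
  proof (cases "chain_pt \<delta> \<in> choice (X \<beta>)")
    case True
    then show ?thesis
      using earlier[OF 1(3)] by (metis underS_iff r_trans)
  next
    case False
    then have \<delta>: "\<delta> \<in> under r \<kappa>" "X \<beta> = K \<delta>"
      using choice_deletedD[OF 1(4)] by auto
    show ?thesis
    proof (rule ccontr)
      assume "(\<delta>, \<beta>) \<notin> r"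
      then have \<beta>: "\<beta> \<in> underS r \<delta>"
        using r_total[of \<delta> \<beta>] r_refl[of \<delta>] 1(2,3)
        by (auto simp: under_def underS_def Field_def)
      then have "chain_pt \<beta> \<in> choice (X \<beta>)"
        using lower_chain_in_choice[OF \<delta>(1)] \<delta>(2) by simp
      moreover have "\<beta> \<in> underS r \<kappa>"
        using \<beta> 1(3) unfolding underS_iff by (metis r_trans r_antisym)
      ultimately show False
        using earlier by (metis underS_iff r_antisym)
    qed
  qed
qed

text \<open>A violation of \<open>\<mu>Cumt\<close> would have \<open>X\<^sub>\<alpha> = K\<^sub>\<gamma>\<close> and \<open>d\<^sub>\<gamma> \<in> \<mu> U\<close>. As \<open>a\<^sub>\<gamma> \<in> U\<close> and
  \<open>U \<noteq> K\<^sub>\<gamma>\<close> (otherwise \<open>\<mu>\<close> would have deleted \<open>d\<^sub>\<gamma>\<close>), there is no \<open>d\<^sub>\<delta>\<close> with \<open>\<delta> < \<kappa>\<close> in \<open>U\<close>, whence \<open>\<gamma> = \<kappa>\<close>. But then \<open>d\<^sub>\<alpha>\<close> would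
  have to occur before position \<open>\<alpha>\<close>.\<close>

lemma mu_Cumt_choice:
  assumes \<alpha>: "\<alpha> \<in> underS r \<kappa>"
  shows "mu_Cumt r \<alpha> family choice"
  unfolding mu_Cumt_def
proof (intro ballI allI impI subsetI)
  fix U X x
  assume U: "U \<in> family" and seq: "Cum_sequence r \<alpha> family choice U X"
    and x: "x \<in> X \<alpha> \<inter> choice U"
  have \<alpha>\<alpha>: "\<alpha> \<in> under r \<alpha>"
    using \<alpha> r_refl[of \<alpha>] by (auto simp: under_def underS_def Field_def)
  show "x \<in> choice (X \<alpha>)"
  proof (rule ccontr)
    assume "x \<notin> choice (X \<alpha>)"
    then obtain \<gamma> where \<gamma>: "\<gamma> \<in> under r \<kappa>" "X \<alpha> = K \<gamma>" "x = chain_pt \<gamma>"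
      using x choice_deletedD[of x "X \<alpha>"] by blast
    have tag: "tag_pt \<gamma> \<in> U"
      using tag_in_start[OF seq \<alpha>\<alpha>] K_has_tag \<gamma>(2) by auto
    have "U \<noteq> K \<gamma>"
      using x \<gamma> choice_K by auto
    then have no_chain: "chain_pt \<delta> \<notin> U" if "\<delta> \<in> underS r \<kappa>" for \<delta>
      using eq_K(1)[OF U tag] that by auto
    have "chain_pt \<gamma> \<in> U"
      using x \<gamma>(3) choice_subset by auto
    then have "\<gamma> = \<kappa>"
      using no_chain[of \<gamma>] \<gamma>(1) by (auto simp: under_def underS_def)
    then have "chain_pt \<alpha> \<in> choice (X \<alpha>)"
      using lower_chain_in_choice[OF \<gamma>(1)] \<alpha> \<gamma>(2) by simp
    then have "chain_pt \<alpha> \<in> U \<union> (\<Union>\<delta>\<in>underS r \<alpha>. X \<delta>)"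
      using seq \<alpha>\<alpha> unfolding Cum_sequence_def by blast
    then obtain \<beta> where \<beta>: "\<beta> \<in> underS r \<alpha>" "chain_pt \<alpha> \<in> X \<beta>"
      using no_chain[OF \<alpha>] by blast
    then have "(\<alpha>, \<beta>) \<in> r"
      using chain_index_le[OF seq no_chain _ \<alpha>] by (auto simp: under_def underS_def)
    then show False
      using \<beta>(1) unfolding underS_iff by (metis r_antisym)
  qed
qed

section \<open>The sequence of length \<open>\<kappa>\<close>\<close>

lemma not_mu_Cum_choice: "\<not> mu_Cum r \<kappa> family choice"
proof
  assume cum: "mu_Cum r \<kappa> family choice"
  have \<kappa>\<kappa>: "\<kappa> \<in> under r \<kappa>"
    using r_refl[OF \<kappa>_Field] by (simp add: under_def)
  have "choice (K \<beta>) \<subseteq> start \<union> (\<Union>\<gamma>\<in>underS r \<beta>. K \<gamma>)" if \<beta>: "\<beta> \<in> under r \<kappa>" for \<beta>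
  proof
    fix x assume "x \<in> choice (K \<beta>)"
    then consider "x = chain_pt \<kappa>" | "x = tag_pt \<beta>" | \<delta> where "\<delta> \<in> underS r \<beta>" "x = chain_pt \<delta>"
      using choice_K[OF \<beta>] by (auto simp: K_def under_def underS_def)
    then show "x \<in> start \<union> (\<Union>\<gamma>\<in>underS r \<beta>. K \<gamma>)"
    proof cases
      case (3 \<delta>)
      then have "\<delta> \<in> under r \<kappa>"
        using \<beta> by (blast intro: underS_under_trans)
      then show ?thesis
        using 3 chain_pt_in_K by auto
    qed (use \<beta> in \<open>auto simp: start_def\<close>)
  qed
  then have "Cum_sequence r \<kappa> family choice start K"
    using K_in_family unfolding Cum_sequence_def by blast
  then have "(\<Inter>\<gamma>\<in>under r \<kappa>. K \<gamma>) \<inter> start \<subseteq> choice (K \<kappa>)"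
    using cum start_in_family choice_start unfolding mu_Cum_def by metis
  then have "chain_pt \<kappa> \<in> choice (K \<kappa>)"
    by (auto simp: K_def start_def)
  then show False
    using choice_K[OF \<kappa>\<kappa>] by simp
qed

end

theorem mainTheorem1:
  fixes r :: "'i rel" and \<kappa> :: 'i
  assumes "Well_order r"
    and "\<kappa> \<in> Field r"
    and "underS r \<kappa> \<noteq> {}"
  shows "\<exists>(Z :: 'i list set) (Y :: 'i list set set) (\<mu> :: 'i list set \<Rightarrow> 'i list set).
           Y \<subseteq> Pow Z \<and> \<mu> \<in> Y \<rightarrow> Pow Z \<and>
           mu_PR Y \<mu> \<and> mu_subset Y \<mu> \<and>
           mu_CUM Y \<mu> \<and>
           Inter_closed Y \<and>
           (\<forall>\<alpha>\<in>underS r \<kappa>. mu_Cumt r \<alpha> Y \<mu>) \<and>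
           \<not> mu_Cum r \<kappa> Y \<mu>"
proof -
  interpret positive_ordinal r \<kappa>
    by unfold_locales (fact assms)+
  have "mu_subset family choice"
    using choice_subset by (auto simp: mu_subset_def)
  then show ?thesis
    using mu_PR_choice mu_CUM_choice Inter_closed_family mu_Cumt_choice not_mu_Cum_choice
    by (intro exI[of _ UNIV] exI[of _ family] exI[of _ choice]) auto
qed

end
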